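(* For every integer $n\geq 2$ we have $C_{\{1\},\{1\}}(n)=n^2$.
   Context: $\mathbb Z_n=\mathbb Z/n\mathbb Z$ as a module over itself. For non-empty $A,B\subseteq\mathbb Z_n$, a sequence $(x_1,\ldots,x_k)$ in $\mathbb Z_n$ is an $(A,B)$-weighted zero-sum sequence if there exist $a_i\in A$, $b_i\in B$ with $\sum a_ix_i=0$ and $\sum b_ia_i=0$. $C_{A,B}(n)$ is the least positive integer $k$ such that every sequence in $\mathbb Z_n$ of length $k$ has an $(A,B)$-weighted zero-sum subsequence having consecutive terms, i.e. a non-empty block $(x_i,x_{i+1},\ldots,x_j)$. *)

theory Defs
  imports "HOL-Number_Theory.Residues" "HOL-Library.Sublist"
begin

abbreviation Zn :: "nat \<Rightarrow> int ring"
  where "Zn n \<equiv> residue_ring (int n)"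

definition weighted_zero_sum :: "nat \<Rightarrow> int set \<Rightarrow> int set \<Rightarrow> int list \<Rightarrow> bool"
  where "weighted_zero_sum n A B xs \<longleftrightarrow>
    (\<exists>a b. (\<forall>i<length xs. a i \<in> A \<and> b i \<in> B) \<and>
      (\<Oplus>\<^bsub>Zn n\<^esub> i\<in>{..<length xs}. a i \<otimes>\<^bsub>Zn n\<^esub> xs ! i) = \<zero>\<^bsub>Zn n\<^esub> \<and>
      (\<Oplus>\<^bsub>Zn n\<^esub> i\<in>{..<length xs}. b i \<otimes>\<^bsub>Zn n\<^esub> a i) = \<zero>\<^bsub>Zn n\<^esub>)"

(* Meant for n \<ge> 2 and non-empty A, B \<subseteq> carrier (Zn n). The set of admissible k is then
   non-empty: fix one a in A and one b in B and apply the pigeonhole principle to the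
   prefix sums in Zn n \<times> Zn n, so LEAST denotes a genuine minimum.
   sublist is the library's relation for contiguous blocks. *)
definition C_const :: "int set \<Rightarrow> int set \<Rightarrow> nat \<Rightarrow> nat"
  where "C_const A B n =
    (LEAST k. k > 0 \<and>
      (\<forall>xs. length xs = k \<and> set xs \<subseteq> carrier (Zn n) \<longrightarrow>
        (\<exists>ys. ys \<noteq> [] \<and> sublist ys xs \<and> weighted_zero_sum n A B ys)))"

end

theory Submission
  imports Defs
begin

text \<open>With all weights equal to 1, a block is a zero-sum block iff \<open>n\<close> divides both its sum and its
length. Among the prefix sums of lengths \<open>0, n, 2 n, \<dots>, n\<^sup>2\<close> two agree modulo \<open>n\<close>, which gives the
upper bound. In the sequence with entry 1 in every \<open>n\<close>-th position and 0 elsewhere, a block of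
length \<open>m n\<close> has sum \<open>m\<close>, so it has no zero-sum block of length less than \<open>n\<^sup>2\<close>.\<close>

text \<open>Singleton weight sets force every weight to be 1, so the first sum is the residue of
  \<open>sum_list xs\<close> and the second just counts the terms.\<close>

lemma weighted_zero_sum_one_iff:
  assumes "n \<ge> 2"
  shows "weighted_zero_sum n {\<one>\<^bsub>Zn n\<^esub>} {\<one>\<^bsub>Zn n\<^esub>} xs \<longleftrightarrow>
    int n dvd sum_list xs \<and> n dvd length xs"
proof -
  interpret residues "int n" "Zn n"
    using assms by unfold_locales auto
  \<comment> \<open>Kept general in \<open>f\<close> to serve both sums, with \<open>f\<close> the
    entries and then the weights \<open>a\<close>. The values of \<open>f\<close> may be any
    integers, since the ring product reduces them modulo \<open>n\<close>.\<close>
  have sum_eq: "(\<Oplus>\<^bsub>Zn n\<^esub> i\<in>{..<length xs}. a i \<otimes>\<^bsub>Zn n\<^esub> f i) = sum f {..<length xs} mod int n"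
    if "\<forall>i<length xs. a i = 1" for a f
  proof -
    have "(\<Oplus>\<^bsub>Zn n\<^esub> i\<in>{..<length xs}. a i \<otimes>\<^bsub>Zn n\<^esub> f i) =
        (\<Oplus>\<^bsub>Zn n\<^esub> i\<in>{..<length xs}. f i mod int n)"
      using that by (intro finsum_cong') (auto simp: res_mult_eq)
    then show ?thesis by (simp add: sum_cong)
  qed
  have "weighted_zero_sum n {\<one>\<^bsub>Zn n\<^esub>} {\<one>\<^bsub>Zn n\<^esub>} xs \<longleftrightarrow>
      (\<Sum>i<length xs. xs ! i) mod int n = 0 \<and> (\<Sum>i<length xs. 1) mod int n = 0"
    (is "_ \<longleftrightarrow> ?R")
  proof
    assume "weighted_zero_sum n {\<one>\<^bsub>Zn n\<^esub>} {\<one>\<^bsub>Zn n\<^esub>} xs"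
    then obtain a b where a: "\<forall>i<length xs. a i = 1" and b: "\<forall>i<length xs. b i = 1"
      and sums: "(\<Oplus>\<^bsub>Zn n\<^esub> i\<in>{..<length xs}. a i \<otimes>\<^bsub>Zn n\<^esub> xs ! i) = 0"
        "(\<Oplus>\<^bsub>Zn n\<^esub> i\<in>{..<length xs}. b i \<otimes>\<^bsub>Zn n\<^esub> a i) = 0"
      unfolding weighted_zero_sum_def res_one_eq res_zero_eq by auto
    moreover have "sum a {..<length xs} = (\<Sum>i<length xs. 1)"
      using a by (intro sum.cong) auto
    ultimately show ?R by (simp add: sum_eq)
  next
    assume ?R
    then show "weighted_zero_sum n {\<one>\<^bsub>Zn n\<^esub>} {\<one>\<^bsub>Zn n\<^esub>} xs"
      unfolding weighted_zero_sum_def res_one_eq res_zero_eq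
      by (intro exI[of _ "\<lambda>_. 1"]) (simp add: sum_eq)
  qed
  then show ?thesis
    by (simp add: sum_list_sum_nth atLeast0LessThan flip: dvd_eq_mod_eq_0)
qed

lemma ex_zero_sum_block:
  fixes xs :: "int list"
  assumes "n > 0" and len: "length xs = n ^ 2"
  shows "\<exists>ys. ys \<noteq> [] \<and> sublist ys xs \<and> int n dvd sum_list ys \<and> n dvd length ys"
proof -
  \<comment> \<open>Cutting only at multiples of \<open>n\<close> makes the length condition
    automatic; the \<open>n + 1\<close> cuts compete for \<open>n\<close> residues.\<close>
  define S where "S j = sum_list (take (j * n) xs) mod int n" for j
  have "S ` {..n} \<subseteq> {0..<int n}"
    using assms by (auto simp: S_def)
  then have "card (S ` {..n}) < card {..n}"
    using card_mono[of "{0..<int n}" "S ` {..n}"] by simp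
  then have "\<not> inj_on S {..n}"
    by (rule pigeonhole)
  then obtain i j where ij: "i < j" "j \<le> n" "S i = S j"
    by (metis atMost_iff linorder_inj_onI' order_less_imp_le)
  define ys where "ys = drop (i * n) (take (j * n) xs)"
  have "take (j * n) xs = take (i * n) xs @ ys"
    using ij by (metis append_take_drop_id less_imp_le min.absorb1 mult_le_mono1 take_take ys_def)
  then have "int n dvd sum_list ys"
    using ij by (auto simp: S_def mod_eq_dvd_iff dvd_diff_commute)
  \<comment> \<open>Because \<open>j \<le> n\<close>, the prefix of length \<open>j * n\<close> fits
    inside \<open>xs\<close> and \<open>take\<close> does not truncate it. As \<open>i < j\<close>,
    this length is also positive.\<close>
  moreover have "length ys = (j - i) * n"
    using ij len by (simp add: ys_def power2_eq_square diff_mult_distrib)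
  moreover have "sublist ys xs"
    unfolding sublist_def ys_def by (metis append.assoc append_take_drop_id)
  ultimately show ?thesis
    using ij assms by (intro exI[of _ ys]) auto
qed

lemma sum_list_telescope:
  fixes f :: "nat \<Rightarrow> int"
  shows "sum_list (map (\<lambda>i. f (Suc i) - f i) [p..<p + l]) = f (p + l) - f p"
  by (induction l) auto

text \<open>Covering every \<open>k < n ^ 2\<close>, not only \<open>n ^ 2 - 1\<close>, gives
  minimality directly, with no monotonicity argument in \<open>k\<close>.\<close>

lemma ex_seq_without_zero_sum_block:
  assumes "n \<ge> 2" and "k < n ^ 2"
  shows "\<exists>xs. length xs = k \<and> set xs \<subseteq> {0..int n - 1} \<and>
    (\<forall>ys. ys \<noteq> [] \<longrightarrow> sublist ys xs \<longrightarrow> n dvd length ys \<longrightarrow> \<not> int n dvd sum_list ys)"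
proof -
  \<comment> \<open>The entry is 1 if \<open>n\<close> divides \<open>Suc i\<close> and 0 otherwise;
    written as an increment of \<open>i div n\<close>, it makes block sums telescope.\<close>
  define xs where "xs = map (\<lambda>i. int (Suc i div n) - int (i div n)) [0..<k]"
  have "set xs \<subseteq> {0..int n - 1}"
    using assms by (auto simp: xs_def div_Suc)
  moreover have "\<not> int n dvd sum_list ys"
    if ne: "ys \<noteq> []" and sub: "sublist ys xs" and dvd: "n dvd length ys" for ys
  proof -
    obtain ps ss where xs: "xs = ps @ ys @ ss"
      using sub by (auto simp: sublist_def)
    define p where "p = length ps"
    obtain m where m: "length ys = n * m"
      using dvd by blast
    have le: "p + n * m \<le> k"
      using arg_cong[OF xs, of length] m by (simp add: xs_def p_def)
    have "ys = take (n * m) (drop p xs)"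
      using m by (simp add: xs p_def)
    also have "\<dots> = map (\<lambda>i. int (Suc i div n) - int (i div n)) [p..<p + n * m]"
      using le by (simp add: xs_def drop_map take_map)
    finally have "sum_list ys = int ((p + n * m) div n) - int (p div n)"
      by (simp only: sum_list_telescope[of "\<lambda>i. int (i div n)"])
    \<comment> \<open>Shifting by \<open>n * m\<close> raises the quotient by exactly
      \<open>m\<close>, wherever the block starts.\<close>
    also have "\<dots> = int m"
      using assms by simp
    finally have "sum_list ys = int m" .
    \<comment> \<open>The block fits into fewer than \<open>n ^ 2\<close> positions, so
      \<open>0 < m < n\<close> and \<open>n\<close> cannot divide \<open>m\<close>.\<close>
    moreover have "n * m < n * n"
      using le assms(2) unfolding power2_eq_square by linarith
    moreover have "m > 0"
      using ne m by (cases m) auto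
    ultimately show ?thesis
      by (auto dest: dvd_imp_le)
  qed
  ultimately show ?thesis
    by (intro exI[of _ xs]) (auto simp: xs_def)
qed

theorem theorem4:
  fixes n :: nat
  assumes "n \<ge> 2"
  shows "C_const {\<one>\<^bsub>Zn n\<^esub>} {\<one>\<^bsub>Zn n\<^esub>} n = n ^ 2"
  unfolding C_const_def weighted_zero_sum_one_iff[OF assms]
proof (rule Least_equality)
  show "n ^ 2 > 0 \<and> (\<forall>xs. length xs = n ^ 2 \<and> set xs \<subseteq> carrier (Zn n) \<longrightarrow>
      (\<exists>ys. ys \<noteq> [] \<and> sublist ys xs \<and> int n dvd sum_list ys \<and> n dvd length ys))"
    using assms ex_zero_sum_block[of n] by simp
next
  fix k
  assume "k > 0 \<and> (\<forall>xs. length xs = k \<and> set xs \<subseteq> carrier (Zn n) \<longrightarrow>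
      (\<exists>ys. ys \<noteq> [] \<and> sublist ys xs \<and> int n dvd sum_list ys \<and> n dvd length ys))"
  moreover have "carrier (Zn n) = {0..int n - 1}"
    by (simp add: residue_ring_def)
  ultimately show "n ^ 2 \<le> k"
    using ex_seq_without_zero_sum_block[OF assms, of k] by (metis not_le)
qed

end
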